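(* Let the kernel $k$ of the integral equation $f(y)+\int_{\mathcal D}k(x,y)f(x)\,d\mu(x)=g(y)$, $y\in\mathcal D$, satisfy $$\|k\|_\infty=\sup_{y\in\mathcal D}\|k(\cdot,y)\|_\infty<\beta_0^{-1},$$ where $\beta_0=\langle p_0,p_0\rangle_\mu=\int_{\mathcal D}d\mu$. Then, for sufficiently large $m$, the iteration process $$\begin{aligned}(I_m+\Phi_{11})\,\mathbf b^{(k+1)}&=\mathbf g^{(G)}-\Phi_{12}\,\mathbf c^{(k)},\\(I_{m+1}+\Phi_{22})\,\mathbf c^{(k+1)}&=\mathbf g^*-\Phi_{21}\,\mathbf b^{(k+1)},\end{aligned}\qquad k=0,1,2,\dots,$$ (with any initial vector $\mathbf c^{(0)}\in\mathbb R^{m+1}$) converges to the vectors $$\mathbf b=[\widehat f^{[1]}_{2m+1}(x_1^{(G)}),\dots,\widehat f^{[1]}_{2m+1}(x_m^{(G)})]^T,\qquad \mathbf c=[\widehat f^{[1]}_{2m+1}(x_1^* ),\dots,\widehat f^{[1]}_{2m+1}(x_{m+1}^* )]^T,$$ that is, to the unique solution of the linear system $$\begin{bmatrix}I_m+\Phi_{11}&\Phi_{12}\\\Phi_{21}&I_{m+1}+\Phi_{22}\end{bmatrix}\begin{bmatrix}\mathbf b\\\mathbf c\end{bmatrix}=\begin{bmatrix}\mathbf g^{(G)}\\\mathbf g^*\end{bmatrix}.$$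
   Context: $\mathcal D\subseteq\mathbb R$ is a bounded or infinite interval and $d\mu$ is a nonnegative measure supported on $\mathcal D$ with infinitely many points of support and finite moments; the weight of the function space is $u\equiv1$. Put $\langle f,g\rangle_\mu=\int_{\mathcal D}f g\,d\mu$. The monic orthogonal polynomials $p_k$ of $d\mu$ satisfy $p_{-1}=0$, $p_0=1$, $p_{k+1}(x)=(x-\alpha_k)p_k(x)-\beta_kp_{k-1}(x)$, with $\alpha_k=\langle xp_k,p_k\rangle_\mu/\langle p_k,p_k\rangle_\mu$ ($k\ge0$), $\beta_k=\langle p_k,p_k\rangle_\mu/\langle p_{k-1},p_{k-1}\rangle_\mu$ ($k\ge1$), $\beta_0=\langle p_0,p_0\rangle_\mu$. $J_m$ is the symmetric tridiagonal $m\times m$ matrix with diagonal $\alpha_0,\dots,\alpha_{m-1}$ and sub-/superdiagonal $\sqrt{\beta_1},\dots,\sqrt{\beta_{m-1}}$. $G_m(f)=\sum_{k=1}^m\lambda_k^{(G)}f(x_k^{(G)})$ is the $m$-point Gauss rule for $d\mu$. The rule $G^*_{m+1}(f)=\sum_{k=1}^{m+1}\lambda_k^*f(x_k^* )$ has as nodes the eigenvalues of $$J^*_{m+1}=\begin{bmatrix}J_m&\sqrt{\beta_m+\beta_{m+1}}\,\mathbf e_m\\ \sqrt{\beta_m+\beta_{m+1}}\,\mathbf e_m^T&\alpha_m\end{bmatrix}$$ ($\mathbf e_m$ the last axis vector of $\mathbb R^m$), and weights $\lambda_k^*=\beta_0 (v^*_{k,1})^2$ with $v^*_{k,1}$ the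 first component of a normalized real eigenvector for $x_k^*$. All nodes are understood to lie in $\mathcal D$. Put $\theta_m^{(1)}=\frac{\beta_{m+1}}{\beta_m+\beta_{m+1}}$, $\theta_m^{(2)}=\frac{\beta_m}{\beta_m+\beta_{m+1}}$, and $$(\Phi_{11})_{ij}=\theta_m^{(1)}\lambda_j^{(G)}k(x_j^{(G)},x_i^{(G)}),\quad(\Phi_{12})_{ij}=\theta_m^{(2)}\lambda_j^*k(x_j^*,x_i^{(G)}),$$ $$(\Phi_{21})_{ij}=\theta_m^{(1)}\lambda_j^{(G)}k(x_j^{(G)},x_i^* ),\quad(\Phi_{22})_{ij}=\theta_m^{(2)}\lambda_j^*k(x_j^*,x_i^* ),$$ of sizes $m\times m$, $m\times(m+1)$, $(m+1)\times m$, $(m+1)\times(m+1)$ respectively; $\mathbf g^{(G)}=[g(x_i^{(G)})]_{i=1}^m$, $\mathbf g^*=[g(x_i^* )]_{i=1}^{m+1}$. $I_n$ is the $n\times n$ identity matrix. The weighted averaged Nystr\"om interpolant $\widehat f^{[1]}_{2m+1}$ is the solution of $$\widehat f^{[1]}_{2m+1}(y)+\theta_m^{(1)}\sum_{j=1}^m\lambda_j^{(G)}k(x_j^{(G)},y)\widehat f^{[1]}_{2m+1}(x_j^{(G)})+\theta_m^{(2)}\sum_{j=1}^{m+1}\lambda_j^*k(x_j^*,y)\widehat f^{[1]}_{2m+1}(x_j^* )=g(y),\quad y\in\mathcal D.$$ *)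

theory Defs
  imports
    "HOL-Analysis.Analysis"
    "HOL-Computational_Algebra.Polynomial"
    "Jordan_Normal_Form.Char_Poly"
begin

(* Vectors and matrices below are those of Jordan_Normal_Form, whose dimension is a
   natural number, not the type-indexed ones of HOL-Analysis. *)
hide_type (open) Finite_Cartesian_Product.vec
hide_const (open) Finite_Cartesian_Product.vec
unbundle no inner_syntax and no vec_syntax
notation Matrix.vec_index (infixl \<open>$\<close> 100)
notation Matrix.scalar_prod (infix \<open>\<bullet>\<close> 70)

definition measure_support :: "real measure \<Rightarrow> real set" where
  "measure_support \<mu> = {x. \<forall>U. open U \<longrightarrow> x \<in> U \<longrightarrow> emeasure \<mu> U > 0}"

definition mu_inner :: "real set \<Rightarrow> real measure \<Rightarrow> (real \<Rightarrow> real) \<Rightarrow> (real \<Rightarrow> real) \<Rightarrow> real" where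
  "mu_inner D \<mu> f g = (LINT x:D|\<mu>. f x * g x)"

definition monic_orthogonal :: "real set \<Rightarrow> real measure \<Rightarrow> (nat \<Rightarrow> real poly) \<Rightarrow> bool" where
  "monic_orthogonal D \<mu> p \<longleftrightarrow>
     (\<forall>n. degree (p n) = n \<and> lead_coeff (p n) = 1) \<and>
     (\<forall>i j. i \<noteq> j \<longrightarrow> mu_inner D \<mu> (poly (p i)) (poly (p j)) = 0)"

definition rec_alpha :: "real set \<Rightarrow> real measure \<Rightarrow> (nat \<Rightarrow> real poly) \<Rightarrow> nat \<Rightarrow> real" where
  "rec_alpha D \<mu> p n =
     mu_inner D \<mu> (\<lambda>x. x * poly (p n) x) (poly (p n)) / mu_inner D \<mu> (poly (p n)) (poly (p n))"

definition rec_beta :: "real set \<Rightarrow> real measure \<Rightarrow> (nat \<Rightarrow> real poly) \<Rightarrow> nat \<Rightarrow> real" where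
  "rec_beta D \<mu> p n =
     (if n = 0 then mu_inner D \<mu> (poly (p 0)) (poly (p 0))
      else mu_inner D \<mu> (poly (p n)) (poly (p n)) /
           mu_inner D \<mu> (poly (p (n - 1))) (poly (p (n - 1))))"

text \<open>
  Indices of nodes, weights, vectors and matrices start at 0 throughout.  The sequences
  \<open>\<alpha>\<close> and \<open>\<beta>\<close> keep their usual numbering, so the entry of the Jacobi
  matrix in positions \<open>(j - 1, j)\<close> and \<open>(j, j - 1)\<close> is \<open>sqrt (\<beta> j)\<close>.
\<close>

definition jacobi_mat :: "(nat \<Rightarrow> real) \<Rightarrow> (nat \<Rightarrow> real) \<Rightarrow> nat \<Rightarrow> real mat" where
  "jacobi_mat \<alpha> \<beta> m =
     mat m m (\<lambda>(i, j). if i = j then \<alpha> i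
                       else if j = Suc i then sqrt (\<beta> j)
                       else if i = Suc j then sqrt (\<beta> i)
                       else 0)"

definition jacobi_star_mat :: "(nat \<Rightarrow> real) \<Rightarrow> (nat \<Rightarrow> real) \<Rightarrow> nat \<Rightarrow> real mat" where
  "jacobi_star_mat \<alpha> \<beta> m =
     (let e = sqrt (\<beta> m + \<beta> (m + 1)) \<cdot>\<^sub>v unit_vec m (m - 1)
      in four_block_mat (jacobi_mat \<alpha> \<beta> m)  (mat_of_cols m [e])
                        (mat_of_rows m [e])   (mat 1 1 (\<lambda>_. \<alpha> m)))"

text \<open>
  The \<open>m\<close>-point Gauss rule is characterised, up to the numbering of its nodes, by being
  exact for all polynomials of degree at most \<open>2 * m - 1\<close>.
\<close>

definition gauss_rule ::
  "real set \<Rightarrow> real measure \<Rightarrow> nat \<Rightarrow> (nat \<Rightarrow> real) \<Rightarrow> (nat \<Rightarrow> real) \<Rightarrow> bool" where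
  "gauss_rule D \<mu> m x w \<longleftrightarrow>
     inj_on x {..<m} \<and>
     (\<forall>q :: real poly. degree q < 2 * m \<longrightarrow>
        (\<Sum>j<m. w j * poly q (x j)) = (LINT t:D|\<mu>. poly q t))"

text \<open>
  The matrix \<open>J\<^sup>*\<close> is symmetric tridiagonal with nonzero off-diagonal entries, so it
  has \<open>m + 1\<close> distinct real eigenvalues and normalized eigenvectors are unique up to sign.
\<close>

definition star_rule ::
  "real set \<Rightarrow> real measure \<Rightarrow> (nat \<Rightarrow> real poly) \<Rightarrow> nat \<Rightarrow>
   (nat \<Rightarrow> real) \<Rightarrow> (nat \<Rightarrow> real) \<Rightarrow> bool" where
  "star_rule D \<mu> p m x w \<longleftrightarrow>
     (let J = jacobi_star_mat (rec_alpha D \<mu> p) (rec_beta D \<mu> p) m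
      in bij_betw x {..<m + 1} {a. eigenvalue J a} \<and>
         (\<forall>j<m + 1. \<exists>v. eigenvector J v (x j) \<and> v \<bullet> v = 1 \<and>
                         w j = rec_beta D \<mu> p 0 * (v $ 0)\<^sup>2))"

definition theta1 :: "(nat \<Rightarrow> real) \<Rightarrow> nat \<Rightarrow> real" where
  "theta1 \<beta> m = \<beta> (m + 1) / (\<beta> m + \<beta> (m + 1))"

definition theta2 :: "(nat \<Rightarrow> real) \<Rightarrow> nat \<Rightarrow> real" where
  "theta2 \<beta> m = \<beta> m / (\<beta> m + \<beta> (m + 1))"

text \<open>
  One block of the Nystrom matrix: quadrature nodes \<open>x\<close> with weights \<open>w\<close>
  (\<open>nc\<close> columns), evaluation points \<open>y\<close> (\<open>nr\<close> rows).
\<close>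

definition nystrom_block ::
  "(real \<Rightarrow> real \<Rightarrow> real) \<Rightarrow> real \<Rightarrow> nat \<Rightarrow> (nat \<Rightarrow> real) \<Rightarrow>
   nat \<Rightarrow> (nat \<Rightarrow> real) \<Rightarrow> (nat \<Rightarrow> real) \<Rightarrow> real mat" where
  "nystrom_block k \<theta> nr y nc x w = mat nr nc (\<lambda>(i, j). \<theta> * w j * k (x j) (y i))"

definition nystrom_interpolant ::
  "real set \<Rightarrow> (real \<Rightarrow> real \<Rightarrow> real) \<Rightarrow> (real \<Rightarrow> real) \<Rightarrow> real \<Rightarrow> real \<Rightarrow> nat \<Rightarrow>
   (nat \<Rightarrow> real) \<Rightarrow> (nat \<Rightarrow> real) \<Rightarrow> (nat \<Rightarrow> real) \<Rightarrow> (nat \<Rightarrow> real) \<Rightarrow> (real \<Rightarrow> real) \<Rightarrow> bool" where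
  "nystrom_interpolant D k g \<theta>1 \<theta>2 m xG wG xS wS f \<longleftrightarrow>
     (\<forall>y\<in>D. f y + \<theta>1 * (\<Sum>j<m. wG j * k (xG j) y * f (xG j))
                 + \<theta>2 * (\<Sum>j<m + 1. wS j * k (xS j) y * f (xS j)) = g y)"

text \<open>The entry \<open>bs 0\<close> of the first sequence plays no role.\<close>

definition block_iteration ::
  "nat \<Rightarrow> real mat \<Rightarrow> real mat \<Rightarrow> real mat \<Rightarrow> real mat \<Rightarrow> real vec \<Rightarrow> real vec \<Rightarrow>
   real vec \<Rightarrow> (nat \<Rightarrow> real vec) \<Rightarrow> (nat \<Rightarrow> real vec) \<Rightarrow> bool" where
  "block_iteration m \<Phi>11 \<Phi>12 \<Phi>21 \<Phi>22 gG gS c0 bs cs \<longleftrightarrow>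
     cs 0 = c0 \<and>
     (\<forall>n. bs (Suc n) \<in> carrier_vec m \<and> cs (Suc n) \<in> carrier_vec (m + 1) \<and>
          (1\<^sub>m m + \<Phi>11) *\<^sub>v bs (Suc n) = gG - \<Phi>12 *\<^sub>v cs n \<and>
          (1\<^sub>m (m + 1) + \<Phi>22) *\<^sub>v cs (Suc n) = gS - \<Phi>21 *\<^sub>v bs (Suc n))"

definition kernel_norm :: "real set \<Rightarrow> (real \<Rightarrow> real \<Rightarrow> real) \<Rightarrow> ereal" where
  "kernel_norm D k = (SUP y\<in>D. SUP x\<in>D. ereal \<bar>k x y\<bar>)"

end

theory Submission
  imports Defs
begin

text \<open>
  Everything follows from one estimate: the coefficient matrix of the linear system is
  \<open>I + \<Phi>\<close> with \<open>\<Phi>\<close> of maximum row sum at most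
  \<open>q = K * \<beta> 0 < 1\<close>, where \<open>K\<close> is the norm of the kernel.  The
  entries of \<open>\<Phi>\<close> are kernel values times the weights of the averaged rule
  \<open>\<theta>1 G + \<theta>2 G\<^sup>*\<close>.  Both rules have nonnegative weights of total mass
  \<open>\<beta> 0\<close>: the Gauss weights because they integrate the squares of the Lagrange basis
  polynomials (\<open>gauss_rule_weight_nonneg\<close>, \<open>gauss_rule_weight_sum\<close>), those of
  \<open>G\<^sup>*\<close> because the first components of an orthonormal eigenbasis form a unit
  vector (\<open>star_rule_weight_sum\<close>).  As \<open>\<theta>1\<close> and \<open>\<theta>2\<close>
  are nonnegative with sum at most one, a row of \<open>\<Phi>\<close> is bounded by \<open>q\<close>
  (\<open>averaged_row_sums_bounded\<close>).

  Such a system, and each of its diagonal blocks, is uniquely solvable.  For the iteration, let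
  \<open>a\<close> and \<open>b\<close> be the sums of absolute values in one row over the diagonal and
  the off-diagonal block of \<open>\<Phi>\<close>.  A half step multiplies the maximum norm of the
  error by at most \<open>b / (1 - a)\<close>, and this is at most \<open>q\<close> because
  \<open>a + b \<le> q < 1\<close> (\<open>dominant_solve_contracts\<close>).  The iteration therefore
  converges geometrically to the solution of the whole system, and it does so for every
  \<open>m > 0\<close>.

  Collocation at the nodes turns the Nystrom equation into this system
  (\<open>block_system_iff_collocation\<close>).  Conversely, the equation recovers the interpolant on
  all of \<open>D\<close> from its nodal values, so existence and uniqueness carry over.
\<close>

section \<open>Diagonally dominant block systems\<close>

text \<open>
  The rows of the composite matrix \<open>(A | B)\<close> are bounded jointly: individual bounds
  \<open>q\<close> for \<open>A\<close> and \<open>B\<close> would only give the factor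
  \<open>q / (1 - q)\<close> for a half step of the block iteration, which may exceed one.
\<close>

definition row_sums_bounded :: "real mat \<Rightarrow> real mat \<Rightarrow> real \<Rightarrow> bool" where
  "row_sums_bounded A B q \<longleftrightarrow>
     (\<forall>i<dim_row A. (\<Sum>j<dim_col A. \<bar>A $$ (i, j)\<bar>) + (\<Sum>j<dim_col B. \<bar>B $$ (i, j)\<bar>) \<le> q)"

lemma index_mult_mat_vec_sum:
  assumes "A \<in> carrier_mat nr nc" "v \<in> carrier_vec nc" "i < nr"
  shows "(A *\<^sub>v v) $ i = (\<Sum>j<nc. A $$ (i, j) * v $ j)"
  using assms by (auto simp: scalar_prod_def lessThan_atLeast0 intro!: sum.cong)

lemma abs_mult_mat_vec_le:
  assumes "A \<in> carrier_mat nr nc" "v \<in> carrier_vec nc" "i < nr"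
    and "\<And>j. j < nc \<Longrightarrow> \<bar>v $ j\<bar> \<le> (M :: real)"
  shows "\<bar>(A *\<^sub>v v) $ i\<bar> \<le> (\<Sum>j<nc. \<bar>A $$ (i, j)\<bar>) * M"
proof -
  have "\<bar>(A *\<^sub>v v) $ i\<bar> \<le> (\<Sum>j<nc. \<bar>A $$ (i, j) * v $ j\<bar>)"
    unfolding index_mult_mat_vec_sum[OF assms(1-3)] by (rule sum_abs)
  also have "\<dots> \<le> (\<Sum>j<nc. \<bar>A $$ (i, j)\<bar> * M)"
    by (rule sum_mono) (auto simp: abs_mult intro!: mult_left_mono assms(4))
  finally show ?thesis by (simp add: sum_distrib_right)
qed

text \<open>
  In the row where \<open>\<bar>v\<bar>\<close> attains its maximum \<open>N\<close>, the equation gives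
  \<open>N \<le> a * N + b * M\<close> with \<open>a\<close> and \<open>b\<close> the absolute row sums of
  \<open>A\<close> and \<open>B\<close>; and \<open>b \<le> q - a \<le> q * (1 - a)\<close>.  With
  \<open>w = 0\<close> this is injectivity of \<open>I + A\<close>; with \<open>w\<close> an error of
  the block iteration it is the contraction of one half step.
\<close>

lemma dominant_solve_contracts:
  assumes A: "A \<in> carrier_mat n n" and B: "B \<in> carrier_mat n l"
    and v: "v \<in> carrier_vec n" and w: "w \<in> carrier_vec l"
    and eq: "(1\<^sub>m n + A) *\<^sub>v v = B *\<^sub>v w"
    and rows: "row_sums_bounded A B q" and q: "q < 1"
    and M: "0 \<le> M" "\<And>j. j < l \<Longrightarrow> \<bar>w $ j\<bar> \<le> M"
    and i: "i < n"
  shows "\<bar>v $ i\<bar> \<le> q * M"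
proof -
  define N where "N = Max ((\<lambda>j. \<bar>v $ j\<bar>) ` {..<n})"
  have vN: "\<bar>v $ j\<bar> \<le> N" if "j < n" for j
    unfolding N_def using that by (intro Max_ge) auto
  have "N \<in> (\<lambda>j. \<bar>v $ j\<bar>) ` {..<n}"
    unfolding N_def using i by (intro Max_in) auto
  then obtain s where s: "s < n" "N = \<bar>v $ s\<bar>" by auto
  define a where "a = (\<Sum>j<n. \<bar>A $$ (s, j)\<bar>)"
  define b where "b = (\<Sum>j<l. \<bar>B $$ (s, j)\<bar>)"
  have ab: "0 \<le> a" "0 \<le> b" "a + b \<le> q"
    using rows s A B by (simp_all add: a_def b_def row_sums_bounded_def sum_nonneg)
  have "v $ s + (A *\<^sub>v v) $ s = (B *\<^sub>v w) $ s"
    unfolding eq[symmetric] using A v s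
    by (subst add_mult_distrib_mat_vec[of _ n n]) auto
  moreover have "\<bar>(A *\<^sub>v v) $ s\<bar> \<le> a * N"
    unfolding a_def by (rule abs_mult_mat_vec_le[OF A v s(1) vN])
  moreover have "\<bar>(B *\<^sub>v w) $ s\<bar> \<le> b * M"
    unfolding b_def by (rule abs_mult_mat_vec_le[OF B w s(1) M(2)])
  ultimately have "N \<le> a * N + b * M"
    using s(2) by linarith
  then have "(1 - a) * N \<le> b * M"
    by (simp add: algebra_simps)
  also have "\<dots> \<le> ((1 - a) * q) * M"
  proof (rule mult_right_mono[OF _ M(1)])
    have "a * q \<le> a" using ab q by (simp add: mult_left_le)
    then show "b \<le> (1 - a) * q" using ab by (simp add: algebra_simps)
  qed
  finally have "(1 - a) * N \<le> (1 - a) * (q * M)" by (simp add: mult.assoc)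
  moreover have "0 < 1 - a" using ab q by linarith
  ultimately have "N \<le> q * M" by (simp only: mult_le_cancel_left_pos)
  then show ?thesis using vN[OF i] by linarith
qed

lemma det_nonzero_imp_inverse:
  fixes A :: "'a :: field mat"
  assumes A: "A \<in> carrier_mat n n" and d: "det A \<noteq> 0"
  obtains B where "B \<in> carrier_mat n n" "A * B = 1\<^sub>m n" "B * A = 1\<^sub>m n"
proof -
  from det_non_zero_imp_unit[OF A d, of undefined] show ?thesis
    using that by (auto simp: Units_def ring_mat_def)
qed

lemma dominant_has_inverse:
  assumes A: "A \<in> carrier_mat n n" and B: "B \<in> carrier_mat n l"
    and rows: "row_sums_bounded A B q" and q: "q < 1"
  obtains C where "C \<in> carrier_mat n n" "(1\<^sub>m n + A) * C = 1\<^sub>m n" "C * (1\<^sub>m n + A) = 1\<^sub>m n"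
proof -
  have "det (1\<^sub>m n + A) \<noteq> 0"
  proof
    assume "det (1\<^sub>m n + A) = 0"
    then obtain v where v: "v \<in> carrier_vec n" "v \<noteq> 0\<^sub>v n" "(1\<^sub>m n + A) *\<^sub>v v = 0\<^sub>v n"
      using det_0_iff_vec_prod_zero_field[of "1\<^sub>m n + A" n] A by auto
    have "B *\<^sub>v 0\<^sub>v l = 0\<^sub>v n" using B by auto
    with v have eq: "(1\<^sub>m n + A) *\<^sub>v v = B *\<^sub>v 0\<^sub>v l" by simp
    have "\<bar>v $ i\<bar> \<le> q * 0" if "i < n" for i
      by (rule dominant_solve_contracts[OF A B v(1) zero_carrier_vec eq rows q _ _ that]) auto
    then have "v = 0\<^sub>v n" using v(1) by (intro eq_vecI) auto
    with v(2) show False ..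
  qed
  then show ?thesis
    using det_nonzero_imp_inverse[of "1\<^sub>m n + A" n] A that by auto
qed

lemma dominant_invertible:
  assumes A: "A \<in> carrier_mat n n" and B: "B \<in> carrier_mat n l"
    and rows: "row_sums_bounded A B q" and q: "q < 1"
  shows "invertible_mat (1\<^sub>m n + A)"
proof -
  obtain C where C: "C \<in> carrier_mat n n" "(1\<^sub>m n + A) * C = 1\<^sub>m n" "C * (1\<^sub>m n + A) = 1\<^sub>m n"
    by (rule dominant_has_inverse[OF assms])
  then show ?thesis
    using A by (auto simp: invertible_mat_def inverts_mat_def intro!: exI[of _ C])
qed

lemma row_sums_bounded_swap:
  assumes "row_sums_bounded A B q" "dim_row A = dim_row B"
  shows "row_sums_bounded B A q"
  using assms by (auto simp: row_sums_bounded_def add.commute)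

text \<open>
  The composite matrix is itself \<open>I + A\<close> with row sums of \<open>A\<close> at most
  \<open>q\<close>, so it is invertible for the same reason as its diagonal blocks; an empty matrix takes
  the place of the off-diagonal block.
\<close>

lemma dominant_block_system_unique_solution:
  assumes A11: "A11 \<in> carrier_mat n n" and A12: "A12 \<in> carrier_mat n l"
    and A21: "A21 \<in> carrier_mat l n" and A22: "A22 \<in> carrier_mat l l"
    and rows1: "row_sums_bounded A11 A12 q" and rows2: "row_sums_bounded A21 A22 q"
    and q: "q < 1" and r: "r \<in> carrier_vec (n + l)"
  shows "\<exists>!z. z \<in> carrier_vec (n + l) \<and>
           four_block_mat (1\<^sub>m n + A11) A12 A21 (1\<^sub>m l + A22) *\<^sub>v z = r"
proof -
  define A where "A = four_block_mat A11 A12 A21 A22"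
  have A: "A \<in> carrier_mat (n + l) (n + l)"
    using A11 A22 by (auto simp: A_def)
  have eq: "four_block_mat (1\<^sub>m n + A11) A12 A21 (1\<^sub>m l + A22) = 1\<^sub>m (n + l) + A"
    using assms(1-4) by (intro eq_matI) (auto simp: A_def)
  have split: "(\<Sum>j<n + l. \<bar>A $$ (i, j)\<bar>) =
      (\<Sum>j<n. \<bar>A $$ (i, j)\<bar>) + (\<Sum>j<l. \<bar>A $$ (i, n + j)\<bar>)" for i
    by (induction l) auto
  have "row_sums_bounded A (0\<^sub>m (n + l) 0) q"
    unfolding row_sums_bounded_def
  proof (intro allI impI)
    fix i assume "i < dim_row A"
    then have i: "i < n + l" using A by auto
    have "(\<Sum>j<n + l. \<bar>A $$ (i, j)\<bar>) \<le> q"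
    proof (cases "i < n")
      case True
      then have "(\<Sum>j<n. \<bar>A11 $$ (i, j)\<bar>) + (\<Sum>j<l. \<bar>A12 $$ (i, j)\<bar>) \<le> q"
        using rows1 A11 A12 by (auto simp: row_sums_bounded_def)
      then show ?thesis
        unfolding split using True assms(1-4) by (simp add: A_def)
    next
      case False
      then have "(\<Sum>j<n. \<bar>A21 $$ (i - n, j)\<bar>) + (\<Sum>j<l. \<bar>A22 $$ (i - n, j)\<bar>) \<le> q"
        using rows2 A21 A22 i by (auto simp: row_sums_bounded_def)
      then show ?thesis
        unfolding split using False i assms(1-4) by (simp add: A_def)
    qed
    then show "(\<Sum>j<dim_col A. \<bar>A $$ (i, j)\<bar>) +
        (\<Sum>j<dim_col (0\<^sub>m (n + l) 0 :: real mat). \<bar>0\<^sub>m (n + l) 0 $$ (i, j)\<bar>) \<le> q"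
      using A by simp
  qed
  then obtain C where C: "C \<in> carrier_mat (n + l) (n + l)"
      "(1\<^sub>m (n + l) + A) * C = 1\<^sub>m (n + l)" "C * (1\<^sub>m (n + l) + A) = 1\<^sub>m (n + l)"
    using dominant_has_inverse[OF A _ _ q] zero_carrier_mat by metis
  have IA: "1\<^sub>m (n + l) + A \<in> carrier_mat (n + l) (n + l)" using A by simp
  show ?thesis unfolding eq
  proof (intro ex1I[of _ "C *\<^sub>v r"] conjI)
    show "C *\<^sub>v r \<in> carrier_vec (n + l)" using C r by simp
    show "(1\<^sub>m (n + l) + A) *\<^sub>v (C *\<^sub>v r) = r"
      using assoc_mult_mat_vec[OF IA C(1) r] C(2) r by simp
  next
    fix z assume z: "z \<in> carrier_vec (n + l) \<and> (1\<^sub>m (n + l) + A) *\<^sub>v z = r"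
    then show "z = C *\<^sub>v r"
      using assoc_mult_mat_vec[OF C(1) IA, of z] C(3) by auto
  qed
qed

lemma bounded_vec: "\<exists>M \<ge> 0. \<forall>j<n. \<bar>(v :: real vec) $ j\<bar> \<le> M"
  by (rule exI[of _ "\<Sum>j<n. \<bar>v $ j\<bar>"]) (auto intro!: sum_nonneg member_le_sum)

text \<open>
  One full step of the block Gauss-Seidel iteration consists of two contractions with factor
  \<open>q\<close>.  The proof keeps the weaker rate \<open>q ^ n\<close> for \<open>n\<close> full steps
  (instead of \<open>q ^ (2 * n)\<close>), which is all that convergence requires.
\<close>

lemma block_iteration_converges:
  assumes A11: "A11 \<in> carrier_mat m m" and A12: "A12 \<in> carrier_mat m (m + 1)"
    and A21: "A21 \<in> carrier_mat (m + 1) m" and A22: "A22 \<in> carrier_mat (m + 1) (m + 1)"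
    and rows1: "row_sums_bounded A11 A12 q" and rows2: "row_sums_bounded A21 A22 q"
    and q: "0 \<le> q" "q < 1"
    and b: "b \<in> carrier_vec m" and c: "c \<in> carrier_vec (m + 1)"
    and eq1: "(1\<^sub>m m + A11) *\<^sub>v b = gG - A12 *\<^sub>v c"
    and eq2: "(1\<^sub>m (m + 1) + A22) *\<^sub>v c = gS - A21 *\<^sub>v b"
    and gG: "gG \<in> carrier_vec m" and gS: "gS \<in> carrier_vec (m + 1)"
    and c0: "c0 \<in> carrier_vec (m + 1)"
    and iter: "block_iteration m A11 A12 A21 A22 gG gS c0 bs cs"
  shows "i < m \<Longrightarrow> (\<lambda>n. bs n $ i) \<longlonglongrightarrow> b $ i"
    and "i < m + 1 \<Longrightarrow> (\<lambda>n. cs n $ i) \<longlonglongrightarrow> c $ i"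
proof -
  have bs: "bs (Suc n) \<in> carrier_vec m" for n
    using iter by (simp add: block_iteration_def)
  have cs: "cs n \<in> carrier_vec (m + 1)" for n
    using iter c0 by (cases n) (simp_all add: block_iteration_def)
  (* Both half steps and the equations of the limit have the form
     "(1 + A) x = g - B y", so the right-hand side cancels in the difference. *)
  have diff: "(1\<^sub>m n + A) *\<^sub>v (x' - x) = B *\<^sub>v (y - y')"
    if "A \<in> carrier_mat n n" "B \<in> carrier_mat n l" "x \<in> carrier_vec n" "x' \<in> carrier_vec n"
      "y \<in> carrier_vec l" "y' \<in> carrier_vec l" "g \<in> carrier_vec n"
      "(1\<^sub>m n + A) *\<^sub>v x = g - B *\<^sub>v y" "(1\<^sub>m n + A) *\<^sub>v x' = g - B *\<^sub>v y'"
    for n l A B x x' y y' and g :: "real vec"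
  proof -
    have "(1\<^sub>m n + A) *\<^sub>v (x' - x) = (g - B *\<^sub>v y') - (g - B *\<^sub>v y)"
      using that by (subst mult_minus_distrib_mat_vec[of _ n n]) auto
    also have "\<dots> = B *\<^sub>v y - B *\<^sub>v y'"
      using that(2,5,6,7) by (intro eq_vecI) auto
    also have "\<dots> = B *\<^sub>v (y - y')"
      using that by (subst mult_minus_distrib_mat_vec[of _ n l]) auto
    finally show ?thesis .
  qed
  have b_step: "\<bar>bs (Suc n) $ i - b $ i\<bar> \<le> q * M"
    if "0 \<le> M" "\<And>j. j < m + 1 \<Longrightarrow> \<bar>cs n $ j - c $ j\<bar> \<le> M" "i < m" for n M i
  proof -
    have "(1\<^sub>m m + A11) *\<^sub>v (bs (Suc n) - b) = A12 *\<^sub>v (c - cs n)"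
      using diff[OF A11 A12 b bs c cs gG eq1] iter by (simp add: block_iteration_def)
    then have "\<bar>(bs (Suc n) - b) $ i\<bar> \<le> q * M"
      using b bs[of n] c cs[of n] that
      by (intro dominant_solve_contracts[OF A11 A12 _ _ _ rows1 q(2)])
         (auto simp: abs_minus_commute)
    then show ?thesis using b that by simp
  qed
  have c_step: "\<bar>cs (Suc n) $ i - c $ i\<bar> \<le> q * M"
    if "0 \<le> M" "\<And>j. j < m \<Longrightarrow> \<bar>bs (Suc n) $ j - b $ j\<bar> \<le> M" "i < m + 1" for n M i
  proof -
    have "(1\<^sub>m (m + 1) + A22) *\<^sub>v (cs (Suc n) - c) = A21 *\<^sub>v (b - bs (Suc n))"
      using diff[OF A22 A21 c cs b bs gS eq2] iter by (simp add: block_iteration_def)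
    moreover have "row_sums_bounded A22 A21 q"
      using A21 A22 by (auto intro: row_sums_bounded_swap[OF rows2])
    ultimately have "\<bar>(cs (Suc n) - c) $ i\<bar> \<le> q * M"
      using c cs[of "Suc n"] b bs[of n] that
      by (intro dominant_solve_contracts[OF A22 A21 _ _ _ _ q(2)])
         (auto simp: abs_minus_commute)
    then show ?thesis using c that by simp
  qed
  obtain M where M: "0 \<le> M" "\<And>j. j < m + 1 \<Longrightarrow> \<bar>cs 0 $ j - c $ j\<bar> \<le> M"
    using bounded_vec[of "m + 1" "cs 0 - c"] c by auto
  have c_err: "\<bar>cs n $ i - c $ i\<bar> \<le> q ^ n * M" if "i < m + 1" for n i
    using that
  proof (induction n arbitrary: i)
    case 0
    then show ?case using M(2) by simp
  next
    case (Suc n)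
    have pos: "0 \<le> q ^ n * M" using q M by simp
    have b_err: "\<bar>bs (Suc n) $ j - b $ j\<bar> \<le> q * (q ^ n * M)" if "j < m" for j
      by (rule b_step[OF pos Suc.IH that])
    have "\<bar>cs (Suc n) $ i - c $ i\<bar> \<le> q * (q * (q ^ n * M))"
      by (rule c_step[OF _ b_err Suc.prems]) (use pos q in simp_all)
    also have "\<dots> \<le> 1 * (q * (q ^ n * M))"
      using pos q by (intro mult_right_mono) simp_all
    finally show ?case by simp
  qed
  have lim: "(\<lambda>n. q ^ n * M) \<longlonglongrightarrow> 0"
    by (rule tendsto_mult_left_zero[OF LIMSEQ_realpow_zero[OF q]])
  show "(\<lambda>n. cs n $ i) \<longlonglongrightarrow> c $ i" if "i < m + 1"
  proof -
    have "(\<lambda>n. cs n $ i - c $ i) \<longlonglongrightarrow> 0"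
      using c_err[OF that] by (intro Lim_null_comparison[OF _ lim]) auto
    then show ?thesis by (simp add: LIM_zero_iff)
  qed
  show "(\<lambda>n. bs n $ i) \<longlonglongrightarrow> b $ i" if "i < m"
  proof -
    have "\<bar>bs (Suc n) $ i - b $ i\<bar> \<le> q * (q ^ n * M)" for n
      by (rule b_step[OF _ c_err that]) (use q M in simp_all)
    then have "(\<lambda>n. bs (Suc n) $ i - b $ i) \<longlonglongrightarrow> 0"
      by (intro Lim_null_comparison[OF _ tendsto_mult_right_zero[OF lim, of q]]) auto
    then have "(\<lambda>n. bs (Suc n) $ i) \<longlonglongrightarrow> b $ i" by (simp add: LIM_zero_iff)
    then show ?thesis by (rule LIMSEQ_imp_Suc[of "\<lambda>n. bs n $ i"])
  qed
qed

section \<open>Positivity and total mass of the quadrature weights\<close>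

text \<open>
  The square of the polynomial of degree \<open>m - 1\<close> that vanishes at all nodes but one still has
  degree below \<open>2 * m\<close>, so the rule is exact for it and isolates a single weight.
\<close>

lemma gauss_rule_weight_nonneg:
  assumes gauss: "gauss_rule D \<mu> m x w" and i: "i < m"
  shows "0 \<le> w i"
proof -
  define L where "L = (\<Prod>j\<in>{..<m} - {i}. [:- x j, 1:])"
  have "degree L \<le> m - 1"
    unfolding L_def using degree_prod_sum_le[of "{..<m} - {i}" "\<lambda>j. [:- x j, 1:]"] i by simp
  then have "degree (L\<^sup>2) < 2 * m"
    using degree_power_le[of L 2] i by linarith
  then have exact: "(\<Sum>j<m. w j * poly (L\<^sup>2) (x j)) = (LINT t:D|\<mu>. poly (L\<^sup>2) t)"
    using gauss unfolding gauss_rule_def by blast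
  have "poly L (x j) = 0" if "j < m" "j \<noteq> i" for j
    using that by (auto simp: L_def poly_prod)
  then have "(\<Sum>j<m. w j * poly (L\<^sup>2) (x j)) = (\<Sum>j<m. if j = i then w i * poly (L\<^sup>2) (x i) else 0)"
    by (intro sum.cong) auto
  then have "w i * (poly L (x i))\<^sup>2 = (LINT t:D|\<mu>. (poly L t)\<^sup>2)"
    using exact i by simp
  also have "\<dots> \<ge> 0"
    unfolding set_lebesgue_integral_def by (intro integral_nonneg_AE) auto
  finally have "0 \<le> w i * (poly L (x i))\<^sup>2" .
  moreover have "0 < (poly L (x i))\<^sup>2"
    using gauss i by (auto simp: L_def poly_prod gauss_rule_def inj_on_def)
  ultimately show ?thesis by (simp add: zero_le_mult_iff)
qed

lemma gauss_rule_weight_sum: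
  assumes gauss: "gauss_rule D \<mu> m x w" and "0 < m" and p: "monic_orthogonal D \<mu> p"
  shows "(\<Sum>j<m. w j) = rec_beta D \<mu> p 0"
proof -
  have deg: "degree (p 0) = 0" and lead: "lead_coeff (p 0) = 1"
    using p unfolding monic_orthogonal_def by blast+
  have "p 0 = 1"
    using deg lead by (auto elim!: degree_eq_zeroE simp: one_pCons)
  moreover have "degree (1 :: real poly) < 2 * m" using \<open>0 < m\<close> by simp
  then have "(\<Sum>j<m. w j * poly 1 (x j)) = (LINT t:D|\<mu>. poly 1 t)"
    using gauss unfolding gauss_rule_def by blast
  ultimately show ?thesis by (simp add: rec_beta_def mu_inner_def)
qed

lemma rec_beta_nonneg: "0 \<le> rec_beta D \<mu> p n"
  by (auto simp: rec_beta_def mu_inner_def set_lebesgue_integral_def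
      intro!: divide_nonneg_nonneg integral_nonneg_AE)

lemma jacobi_star_mat_symmetric:
  "transpose_mat (jacobi_star_mat \<alpha> \<beta> m) = jacobi_star_mat \<alpha> \<beta> m"
proof -
  have "transpose_mat (jacobi_mat \<alpha> \<beta> m) = jacobi_mat \<alpha> \<beta> m"
    by (rule eq_matI) (auto simp: jacobi_mat_def)
  moreover have "transpose_mat (mat 1 1 (\<lambda>_. \<alpha> m)) = mat 1 1 (\<lambda>_. \<alpha> m)"
    by (rule eq_matI) auto
  ultimately show ?thesis
    unfolding jacobi_star_mat_def Let_def
    by (subst transpose_four_block_mat[of _ m m _ 1 _ 1])
       (auto simp: transpose_mat_of_rows transpose_mat_of_cols jacobi_mat_def)
qed

lemma symmetric_eigenvectors_orthogonal:
  fixes S :: "real mat"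
  assumes S: "S \<in> carrier_mat n n" "transpose_mat S = S"
    and v: "eigenvector S v a" and w: "eigenvector S w b" and "a \<noteq> b"
  shows "v \<bullet> w = 0"
proof -
  have vw: "v \<in> carrier_vec n" "w \<in> carrier_vec n" "S *\<^sub>v v = a \<cdot>\<^sub>v v" "S *\<^sub>v w = b \<cdot>\<^sub>v w"
    using S v w by (auto simp: eigenvector_def)
  have "a * (v \<bullet> w) = b * (v \<bullet> w)"
    using transpose_vec_mult_scalar[OF S(1) vw(2) vw(1)] vw S(2) by simp
  with \<open>a \<noteq> b\<close> show ?thesis by simp
qed

text \<open>
  The matrix with rows \<open>v i\<close> has its transpose as a right inverse, hence also as a left
  inverse, so its columns are unit vectors as well.
\<close>

lemma orthonormal_family_sum_component_squares:
  fixes v :: "nat \<Rightarrow> real vec"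
  assumes v: "\<And>i. i < n \<Longrightarrow> v i \<in> carrier_vec n"
    and on: "\<And>i j. i < n \<Longrightarrow> j < n \<Longrightarrow> v i \<bullet> v j = (if i = j then 1 else 0)"
    and s: "s < n"
  shows "(\<Sum>i<n. (v i $ s)\<^sup>2) = 1"
proof -
  define V where "V = mat n n (\<lambda>(i, j). v i $ j)"
  have V: "V \<in> carrier_mat n n" by (simp add: V_def)
  have row: "row V i = v i" if "i < n" for i
    using v[OF that] that by (intro eq_vecI) (auto simp: V_def)
  have "V * transpose_mat V = 1\<^sub>m n"
    using V on by (intro eq_matI) (auto simp: row)
  then have "transpose_mat V * V = 1\<^sub>m n"
    using mat_mult_left_right_inverse[of V n "transpose_mat V"] V by simp
  then have "(transpose_mat V * V) $$ (s, s) = 1" using s by simp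
  moreover have "(transpose_mat V * V) $$ (s, s) = (\<Sum>i<n. (v i $ s)\<^sup>2)"
    using V s by (auto simp: scalar_prod_def V_def power2_eq_square lessThan_atLeast0)
  ultimately show ?thesis by simp
qed

lemma star_rule_weight_nonneg:
  assumes "star_rule D \<mu> p m x w" "j < m + 1"
  shows "0 \<le> w j"
proof -
  obtain v :: "real vec" where "w j = rec_beta D \<mu> p 0 * (v $ 0)\<^sup>2"
    using assms unfolding star_rule_def Let_def by blast
  then show ?thesis by (simp add: rec_beta_nonneg)
qed

text \<open>
  The nodes are \<open>m + 1\<close> distinct eigenvalues of a symmetric matrix of that size, so the
  normalized eigenvectors form an orthonormal basis and their first components square-sum to one.
\<close>

lemma star_rule_weight_sum:
  assumes star: "star_rule D \<mu> p m x w"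
  shows "(\<Sum>j<m + 1. w j) = rec_beta D \<mu> p 0"
proof -
  define J where "J = jacobi_star_mat (rec_alpha D \<mu> p) (rec_beta D \<mu> p) m"
  have J: "J \<in> carrier_mat (m + 1) (m + 1)" "transpose_mat J = J"
    unfolding J_def jacobi_star_mat_symmetric
    by (auto simp: jacobi_star_mat_def jacobi_mat_def Let_def)
  have inj: "inj_on x {..<m + 1}"
    using star by (auto simp: star_rule_def bij_betw_def Let_def)
  have "\<forall>j<m + 1. \<exists>v. eigenvector J v (x j) \<and> v \<bullet> v = 1 \<and> w j = rec_beta D \<mu> p 0 * (v $ 0)\<^sup>2"
    using star by (simp add: star_rule_def J_def Let_def)
  then obtain v where v: "\<And>j. j < m + 1 \<Longrightarrow> eigenvector J (v j) (x j)"
      "\<And>j. j < m + 1 \<Longrightarrow> v j \<bullet> v j = 1"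
      "\<And>j. j < m + 1 \<Longrightarrow> w j = rec_beta D \<mu> p 0 * (v j $ 0)\<^sup>2"
    by metis
  have "(\<Sum>j<m + 1. w j) = rec_beta D \<mu> p 0 * (\<Sum>j<m + 1. (v j $ 0)\<^sup>2)"
    unfolding sum_distrib_left using v(3) by (intro sum.cong) auto
  also have "(\<Sum>j<m + 1. (v j $ 0)\<^sup>2) = 1"
  proof (rule orthonormal_family_sum_component_squares)
    show "v i \<in> carrier_vec (m + 1)" if "i < m + 1" for i
      using v(1)[OF that] J by (auto simp: eigenvector_def)
    show "v i \<bullet> v j = (if i = j then 1 else 0)" if "i < m + 1" "j < m + 1" for i j
    proof (cases "i = j")
      case False
      then have "x i \<noteq> x j" using inj that by (auto simp: inj_on_def)
      with symmetric_eigenvectors_orthogonal[OF J v(1)[OF that(1)] v(1)[OF that(2)]] False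
      show ?thesis by simp
    qed (use v(2) that in simp)
  qed simp
  finally show ?thesis by simp
qed

section \<open>The averaged Nystrom system\<close>

lemma nystrom_block_carrier: "nystrom_block k \<theta> nr y nc x w \<in> carrier_mat nr nc"
  by (simp add: nystrom_block_def)

lemma nystrom_block_mult_vec_index:
  assumes "v \<in> carrier_vec nc" "i < nr"
  shows "(nystrom_block k \<theta> nr y nc x w *\<^sub>v v) $ i = \<theta> * (\<Sum>j<nc. w j * k (x j) (y i) * v $ j)"
  using assms
  by (subst index_mult_mat_vec_sum[OF nystrom_block_carrier])
     (auto simp: nystrom_block_def sum_distrib_left mult.assoc intro!: sum.cong)

lemma nystrom_block_row_sum_le:
  assumes "0 \<le> \<theta>" "\<And>j. j < nc \<Longrightarrow> 0 \<le> w j"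
    and "\<And>j. j < nc \<Longrightarrow> \<bar>k (x j) (y i)\<bar> \<le> K" "i < nr"
  shows "(\<Sum>j<nc. \<bar>nystrom_block k \<theta> nr y nc x w $$ (i, j)\<bar>) \<le> \<theta> * (K * (\<Sum>j<nc. w j))"
proof -
  have "(\<Sum>j<nc. \<bar>nystrom_block k \<theta> nr y nc x w $$ (i, j)\<bar>) \<le> (\<Sum>j<nc. \<theta> * (K * w j))"
  proof (rule sum_mono)
    fix j assume "j \<in> {..<nc}"
    then show "\<bar>nystrom_block k \<theta> nr y nc x w $$ (i, j)\<bar> \<le> \<theta> * (K * w j)"
      using assms by (simp add: nystrom_block_def abs_mult mult.assoc mult_left_mono
          mult_right_mono mult.commute[of K])
  qed
  then show ?thesis by (simp add: sum_distrib_left)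
qed

text \<open>
  Evaluation points \<open>y\<close> are arbitrary points of \<open>D\<close>, so that both block rows
  of the system (evaluation at the Gauss nodes and at the nodes of \<open>G\<^sup>*\<close>) are
  instances.
\<close>

lemma averaged_row_sums_bounded:
  assumes "0 \<le> \<theta>1" "0 \<le> \<theta>2" "\<theta>1 + \<theta>2 \<le> 1" "0 \<le> K * B"
    and "\<And>j. j < n1 \<Longrightarrow> 0 \<le> w1 j" "\<And>j. j < n2 \<Longrightarrow> 0 \<le> w2 j"
    and "(\<Sum>j<n1. w1 j) = B" "(\<Sum>j<n2. w2 j) = B"
    and k: "\<And>s t. s \<in> D \<Longrightarrow> t \<in> D \<Longrightarrow> \<bar>k s t\<bar> \<le> K"
    and nodes: "x1 ` {..<n1} \<subseteq> D" "x2 ` {..<n2} \<subseteq> D" "y ` {..<nr} \<subseteq> D"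
  shows "row_sums_bounded (nystrom_block k \<theta>1 nr y n1 x1 w1)
           (nystrom_block k \<theta>2 nr y n2 x2 w2) (K * B)"
  unfolding row_sums_bounded_def
proof (intro allI impI)
  let ?A = "nystrom_block k \<theta>1 nr y n1 x1 w1" and ?B = "nystrom_block k \<theta>2 nr y n2 x2 w2"
  fix i assume "i < dim_row ?A"
  then have i: "i < nr" by (simp add: nystrom_block_def)
  have "(\<Sum>j<n1. \<bar>?A $$ (i, j)\<bar>) \<le> \<theta>1 * (K * (\<Sum>j<n1. w1 j))"
    using assms(1,5) i nodes by (intro nystrom_block_row_sum_le k) auto
  moreover have "(\<Sum>j<n2. \<bar>?B $$ (i, j)\<bar>) \<le> \<theta>2 * (K * (\<Sum>j<n2. w2 j))"
    using assms(2,6) i nodes by (intro nystrom_block_row_sum_le k) auto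
  moreover have "(\<theta>1 + \<theta>2) * (K * B) \<le> K * B"
    using assms by (intro mult_left_le_one_le) auto
  ultimately have "(\<Sum>j<n1. \<bar>?A $$ (i, j)\<bar>) + (\<Sum>j<n2. \<bar>?B $$ (i, j)\<bar>) \<le> K * B"
    unfolding assms(7,8) by (simp add: distrib_right)
  then show "(\<Sum>j<dim_col ?A. \<bar>?A $$ (i, j)\<bar>) + (\<Sum>j<dim_col ?B. \<bar>?B $$ (i, j)\<bar>) \<le> K * B"
    by (simp add: nystrom_block_def)
qed

text \<open>
  The sum is one unless \<open>\<beta> m + \<beta> (m + 1) = 0\<close>, when division by zero makes both
  coefficients zero; the bound covers both cases and suffices for the row sums.
\<close>

lemma theta_nonneg_sum_le_one:
  assumes "\<And>n. 0 \<le> \<beta> n"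
  shows "0 \<le> theta1 \<beta> m" "0 \<le> theta2 \<beta> m" "theta1 \<beta> m + theta2 \<beta> m \<le> 1"
proof -
  show "0 \<le> theta1 \<beta> m" "0 \<le> theta2 \<beta> m" using assms by (simp_all add: theta1_def theta2_def)
  show "theta1 \<beta> m + theta2 \<beta> m \<le> 1"
    using divide_self_if[of "\<beta> m + \<beta> (m + 1)"]
    by (simp add: theta1_def theta2_def add.commute flip: add_divide_distrib)
qed

text \<open>
  A point of \<open>D\<close> is required because the supremum over the empty set is \<open>- \<infinity>\<close>.
\<close>

lemma kernel_norm_bound:
  assumes small: "kernel_norm D k < ereal (inverse \<beta>0)" and "D \<noteq> {}"
  obtains K where "\<And>s t. s \<in> D \<Longrightarrow> t \<in> D \<Longrightarrow> \<bar>k s t\<bar> \<le> K" "0 \<le> K" "K * \<beta>0 < 1"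
proof -
  define K where "K = real_of_ereal (kernel_norm D k)"
  have le: "ereal \<bar>k s t\<bar> \<le> kernel_norm D k" if "s \<in> D" "t \<in> D" for s t
    unfolding kernel_norm_def using that by (meson SUP_upper order_trans)
  obtain d where d: "d \<in> D" using \<open>D \<noteq> {}\<close> by auto
  have pos: "0 \<le> kernel_norm D k" using le[OF d d] by (auto intro: order_trans[rotated])
  then have K: "kernel_norm D k = ereal K"
    unfolding K_def using small by (cases "kernel_norm D k") auto
  show ?thesis
  proof
    show "\<bar>k s t\<bar> \<le> K" if "s \<in> D" "t \<in> D" for s t using le[OF that] by (simp add: K)
    show "0 \<le> K" using pos by (simp add: K)
    moreover have "K < inverse \<beta>0" using small by (simp add: K)
    ultimately have "0 < \<beta>0" by (metis inverse_positive_iff_positive le_less_trans)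
    with \<open>K < inverse \<beta>0\<close> show "K * \<beta>0 < 1" by (simp add: field_simps)
  qed
qed

text \<open>
  Row \<open>i\<close> of the system is the Nystrom equation at the \<open>i\<close>th node of the two
  rules together, with \<open>b\<close> and \<open>c\<close> as the nodal values of the unknown function.
\<close>

lemma block_system_iff_collocation:
  fixes k :: "real \<Rightarrow> real \<Rightarrow> real" and g xG wG xS wS and \<theta>1 \<theta>2 :: real
  assumes b: "b \<in> carrier_vec m" and c: "c \<in> carrier_vec l"
  defines "S \<equiv> \<lambda>y. \<theta>1 * (\<Sum>j<m. wG j * k (xG j) y * b $ j)
                   + \<theta>2 * (\<Sum>j<l. wS j * k (xS j) y * c $ j)"
  shows "four_block_mat (1\<^sub>m m + nystrom_block k \<theta>1 m xG m xG wG) (nystrom_block k \<theta>2 m xG l xS wS)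
           (nystrom_block k \<theta>1 l xS m xG wG) (1\<^sub>m l + nystrom_block k \<theta>2 l xS l xS wS) *\<^sub>v (b @\<^sub>v c)
         = vec m (\<lambda>i. g (xG i)) @\<^sub>v vec l (\<lambda>i. g (xS i))
       \<longleftrightarrow> (\<forall>i<m. b $ i + S (xG i) = g (xG i)) \<and> (\<forall>i<l. c $ i + S (xS i) = g (xS i))"
    (is "four_block_mat (1\<^sub>m m + ?A) ?B ?C (1\<^sub>m l + ?E) *\<^sub>v _ = ?gG @\<^sub>v ?gS \<longleftrightarrow> _")
proof -
  note carr = nystrom_block_carrier[of k]
  have "four_block_mat (1\<^sub>m m + ?A) ?B ?C (1\<^sub>m l + ?E) *\<^sub>v (b @\<^sub>v c) = ?gG @\<^sub>v ?gS \<longleftrightarrow>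
      (1\<^sub>m m + ?A) *\<^sub>v b + ?B *\<^sub>v c = ?gG \<and> ?C *\<^sub>v b + (1\<^sub>m l + ?E) *\<^sub>v c = ?gS"
    by (subst four_block_mat_mult_vec[OF add_carrier_mat[OF carr] carr carr add_carrier_mat[OF carr] b c],
        rule append_vec_eq[of _ m])
       (intro carrier_vecI, simp add: nystrom_block_def)+
  moreover have "((1\<^sub>m m + ?A) *\<^sub>v b + ?B *\<^sub>v c) $ i = b $ i + S (xG i)" if "i < m" for i
    using that b c carr[of \<theta>1 m xG m xG wG] carr[of \<theta>2 m xG l xS wS]
    by (simp add: add_mult_distrib_mat_vec[OF one_carrier_mat carr b] S_def
        nystrom_block_mult_vec_index del: index_mult_mat_vec)
  moreover have "(?C *\<^sub>v b + (1\<^sub>m l + ?E) *\<^sub>v c) $ i = c $ i + S (xS i)" if "i < l" for i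
    using that b c carr[of \<theta>1 l xS m xG wG] carr[of \<theta>2 l xS l xS wS]
    by (simp add: add_mult_distrib_mat_vec[OF one_carrier_mat carr c] S_def
        nystrom_block_mult_vec_index del: index_mult_mat_vec)
  moreover have "dim_vec ((1\<^sub>m m + ?A) *\<^sub>v b + ?B *\<^sub>v c) = m"
      "dim_vec (?C *\<^sub>v b + (1\<^sub>m l + ?E) *\<^sub>v c) = l"
    by (simp_all add: nystrom_block_def)
  ultimately show ?thesis
    by (auto simp: vec_eq_iff simp del: index_mult_mat_vec index_add_vec)
qed

theorem theorem5p1:
  fixes D :: "real set" and \<mu> :: "real measure" and p :: "nat \<Rightarrow> real poly"
    and k :: "real \<Rightarrow> real \<Rightarrow> real" and g :: "real \<Rightarrow> real"
  defines "\<beta> \<equiv> rec_beta D \<mu> p"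
  assumes "is_interval D"
    and "sets \<mu> = sets borel"
    and "emeasure \<mu> (- D) = 0"
    and "infinite (measure_support \<mu>)"
    and "\<And>n :: nat. set_integrable \<mu> D (\<lambda>x. x ^ n)"
    and "monic_orthogonal D \<mu> p"
    and "kernel_norm D k < ereal (inverse (\<beta> 0))"
  shows "\<forall>\<^sub>F m in sequentially. \<forall>xG wG xS wS.
    gauss_rule D \<mu> m xG wG \<longrightarrow> star_rule D \<mu> p m xS wS \<longrightarrow>
    xG ` {..<m} \<subseteq> D \<longrightarrow> xS ` {..<m + 1} \<subseteq> D \<longrightarrow>
    (let \<theta>1 = theta1 \<beta> m; \<theta>2 = theta2 \<beta> m;
         \<Phi>11 = nystrom_block k \<theta>1 m xG m xG wG;
         \<Phi>12 = nystrom_block k \<theta>2 m xG (m + 1) xS wS;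
         \<Phi>21 = nystrom_block k \<theta>1 (m + 1) xS m xG wG;
         \<Phi>22 = nystrom_block k \<theta>2 (m + 1) xS (m + 1) xS wS;
         gG = vec m (\<lambda>i. g (xG i)); gS = vec (m + 1) (\<lambda>i. g (xS i))
     in \<exists>f. nystrom_interpolant D k g \<theta>1 \<theta>2 m xG wG xS wS f \<and>
          (\<forall>h. nystrom_interpolant D k g \<theta>1 \<theta>2 m xG wG xS wS h \<longrightarrow> (\<forall>y\<in>D. h y = f y)) \<and>
          (let b = vec m (\<lambda>i. f (xG i)); c = vec (m + 1) (\<lambda>i. f (xS i))
           in (\<forall>v\<in>carrier_vec (m + (m + 1)).
                 four_block_mat (1\<^sub>m m + \<Phi>11) \<Phi>12 \<Phi>21 (1\<^sub>m (m + 1) + \<Phi>22) *\<^sub>v v = gG @\<^sub>v gS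
                   \<longleftrightarrow> v = b @\<^sub>v c) \<and>
              invertible_mat (1\<^sub>m m + \<Phi>11) \<and> invertible_mat (1\<^sub>m (m + 1) + \<Phi>22) \<and>
              (\<forall>c0\<in>carrier_vec (m + 1). \<forall>bs cs.
                 block_iteration m \<Phi>11 \<Phi>12 \<Phi>21 \<Phi>22 gG gS c0 bs cs \<longrightarrow>
                   (\<forall>i<m. (\<lambda>n. bs n $ i) \<longlonglongrightarrow> b $ i) \<and>
                   (\<forall>i<m + 1. (\<lambda>n. cs n $ i) \<longlonglongrightarrow> c $ i))))"
proof (rule eventually_mono[OF eventually_gt_at_top[of 0]], intro allI impI, goal_cases)
  case (1 m xG wG xS wS)
  have m: "0 < m" and gauss: "gauss_rule D \<mu> m xG wG" and star: "star_rule D \<mu> p m xS wS"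
    and nodes: "xG ` {..<m} \<subseteq> D" "xS ` {..<m + 1} \<subseteq> D"
    using 1 by auto
  define \<theta>1 \<theta>2 where "\<theta>1 = theta1 \<beta> m" and "\<theta>2 = theta2 \<beta> m"
  define A B C E where
    "A = nystrom_block k \<theta>1 m xG m xG wG" and
    "B = nystrom_block k \<theta>2 m xG (m + 1) xS wS" and
    "C = nystrom_block k \<theta>1 (m + 1) xS m xG wG" and
    "E = nystrom_block k \<theta>2 (m + 1) xS (m + 1) xS wS"
  note ABCE = A_def B_def C_def E_def
  define gG gS where "gG = vec m (\<lambda>i. g (xG i))" and "gS = vec (m + 1) (\<lambda>i. g (xS i))"
  have carr: "A \<in> carrier_mat m m" "B \<in> carrier_mat m (m + 1)"
      "C \<in> carrier_mat (m + 1) m" "E \<in> carrier_mat (m + 1) (m + 1)"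
      "gG \<in> carrier_vec m" "gS \<in> carrier_vec (m + 1)"
    by (simp_all add: ABCE nystrom_block_carrier gG_def gS_def)

  have "xG 0 \<in> D" using nodes m by auto
  then obtain K where K: "\<And>s t. s \<in> D \<Longrightarrow> t \<in> D \<Longrightarrow> \<bar>k s t\<bar> \<le> K" "0 \<le> K"
      "K * \<beta> 0 < 1"
    using kernel_norm_bound[OF assms(8)] by blast
  define q where "q = K * \<beta> 0"
  have q: "0 \<le> q" "q < 1" using K rec_beta_nonneg by (simp_all add: q_def \<beta>_def)
  have \<theta>: "0 \<le> \<theta>1" "0 \<le> \<theta>2" "\<theta>1 + \<theta>2 \<le> 1"
    unfolding \<theta>1_def \<theta>2_def \<beta>_def by (intro theta_nonneg_sum_le_one rec_beta_nonneg)+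
  have rows: "row_sums_bounded (nystrom_block k \<theta>1 nr y m xG wG)
      (nystrom_block k \<theta>2 nr y (m + 1) xS wS) q" if "y ` {..<nr} \<subseteq> D" for nr y
    unfolding q_def
  proof (rule averaged_row_sums_bounded[OF \<theta>])
    show "0 \<le> K * \<beta> 0" using q by (simp add: q_def)
    show "0 \<le> wG j" if "j < m" for j by (rule gauss_rule_weight_nonneg[OF gauss that])
    show "0 \<le> wS j" if "j < m + 1" for j by (rule star_rule_weight_nonneg[OF star that])
    show "(\<Sum>j<m. wG j) = \<beta> 0"
      unfolding \<beta>_def by (rule gauss_rule_weight_sum[OF gauss m assms(7)])
    show "(\<Sum>j<m + 1. wS j) = \<beta> 0"
      unfolding \<beta>_def by (rule star_rule_weight_sum[OF star])
  qed (use K nodes that in auto)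
  have rows1: "row_sums_bounded A B q" and rows2: "row_sums_bounded C E q"
    unfolding ABCE by (rule rows, fact nodes)+
  have rows2': "row_sums_bounded E C q"
    using carr by (auto intro: row_sums_bounded_swap[OF rows2])

  define M where "M = four_block_mat (1\<^sub>m m + A) B C (1\<^sub>m (m + 1) + E)"
  have "\<exists>!z. z \<in> carrier_vec (m + (m + 1)) \<and> M *\<^sub>v z = gG @\<^sub>v gS"
    unfolding M_def
    by (rule dominant_block_system_unique_solution[OF carr(1-4) rows1 rows2 q(2)
          append_carrier_vec[OF carr(5,6)]])
  then obtain z where z: "z \<in> carrier_vec (m + (m + 1))" "M *\<^sub>v z = gG @\<^sub>v gS"
      and z_unique: "\<And>z'. z' \<in> carrier_vec (m + (m + 1)) \<Longrightarrow> M *\<^sub>v z' = gG @\<^sub>v gS \<Longrightarrow> z' = z"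
    by metis
  define b c where "b = vec_first z m" and "c = vec_last z (m + 1)"
  have bc: "b \<in> carrier_vec m" "c \<in> carrier_vec (m + 1)" "z = b @\<^sub>v c"
    using z(1) by (simp_all add: b_def c_def)
  define S where "S b' c' y = \<theta>1 * (\<Sum>j<m. wG j * k (xG j) y * b' $ j)
      + \<theta>2 * (\<Sum>j<m + 1. wS j * k (xS j) y * c' $ j)" for b' c' :: "real vec" and y
  have system_iff: "M *\<^sub>v (b' @\<^sub>v c') = gG @\<^sub>v gS \<longleftrightarrow>
      (\<forall>i<m. b' $ i + S b' c' (xG i) = g (xG i)) \<and> (\<forall>i<m + 1. c' $ i + S b' c' (xS i) = g (xS i))"
    if "b' \<in> carrier_vec m" "c' \<in> carrier_vec (m + 1)" for b' c'
    unfolding M_def ABCE gG_def gS_def S_def by (rule block_system_iff_collocation[OF that])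
  have interpolant_iff: "nystrom_interpolant D k g \<theta>1 \<theta>2 m xG wG xS wS h \<longleftrightarrow>
      (\<forall>y\<in>D. h y + S (vec m (\<lambda>i. h (xG i))) (vec (m + 1) (\<lambda>i. h (xS i))) y = g y)" for h
    by (simp add: nystrom_interpolant_def S_def add.assoc del: sum.lessThan_Suc)
  have node_values: "vec m (\<lambda>i. h (xG i)) = b \<and> vec (m + 1) (\<lambda>i. h (xS i)) = c"
    if h: "nystrom_interpolant D k g \<theta>1 \<theta>2 m xG wG xS wS h" for h
  proof -
    let ?b = "vec m (\<lambda>i. h (xG i))" and ?c = "vec (m + 1) (\<lambda>i. h (xS i))"
    have "M *\<^sub>v (?b @\<^sub>v ?c) = gG @\<^sub>v gS"
      using h nodes by (subst system_iff) (auto simp: interpolant_iff)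
    then have "?b @\<^sub>v ?c = b @\<^sub>v c"
      using z_unique[OF append_carrier_vec[OF vec_carrier vec_carrier]] bc(3) by simp
    then show ?thesis using append_vec_eq[of ?b m b] bc(1) by simp
  qed

  (* The Nystrom equation read as a formula for the interpolant in terms of its nodal values. *)
  define f where "f y = g y - S b c y" for y
  have f_nodes: "vec m (\<lambda>i. f (xG i)) = b" "vec (m + 1) (\<lambda>i. f (xS i)) = c"
    using system_iff[OF bc(1,2)] z(2) bc by (auto simp: f_def vec_eq_iff algebra_simps)
  have f: "nystrom_interpolant D k g \<theta>1 \<theta>2 m xG wG xS wS f"
    unfolding interpolant_iff f_nodes by (simp add: f_def)
  have f_unique: "h y = f y"
    if h: "nystrom_interpolant D k g \<theta>1 \<theta>2 m xG wG xS wS h" and "y \<in> D" for h y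
  proof -
    have "h y + S b c y = g y"
      using h \<open>y \<in> D\<close> node_values[OF h] by (simp add: interpolant_iff)
    then show ?thesis by (simp add: f_def)
  qed
  have solution: "M *\<^sub>v v = gG @\<^sub>v gS \<longleftrightarrow> v = b @\<^sub>v c"
    if "v \<in> carrier_vec (m + (m + 1))" for v
    using z z_unique[OF that] bc(3) by auto

  have "(1\<^sub>m m + A) *\<^sub>v b + B *\<^sub>v c = gG \<and> C *\<^sub>v b + (1\<^sub>m (m + 1) + E) *\<^sub>v c = gS"
  proof -
    have "M *\<^sub>v (b @\<^sub>v c) =
        ((1\<^sub>m m + A) *\<^sub>v b + B *\<^sub>v c) @\<^sub>v (C *\<^sub>v b + (1\<^sub>m (m + 1) + E) *\<^sub>v c)"
      unfolding M_def using carr bc by (intro four_block_mat_mult_vec) auto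
    moreover have "(1\<^sub>m m + A) *\<^sub>v b + B *\<^sub>v c \<in> carrier_vec m"
      by (rule carrier_vecI) (use carr in auto)
    ultimately show ?thesis
      using z(2) append_vec_eq[OF _ carr(5)] unfolding bc(3) by metis
  qed
  then have eqs: "(1\<^sub>m m + A) *\<^sub>v b = gG - B *\<^sub>v c" "(1\<^sub>m (m + 1) + E) *\<^sub>v c = gS - C *\<^sub>v b"
    using carr bc by (auto intro!: eq_vecI)
  have converges: "(\<forall>i<m. (\<lambda>n. bs n $ i) \<longlonglongrightarrow> b $ i) \<and> (\<forall>i<m + 1. (\<lambda>n. cs n $ i) \<longlonglongrightarrow> c $ i)"
    if "c0 \<in> carrier_vec (m + 1)" "block_iteration m A B C E gG gS c0 bs cs" for c0 bs cs
    using block_iteration_converges[OF carr(1-4) rows1 rows2 q bc(1,2) eqs carr(5,6) that] by blast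

  show ?case
    unfolding Let_def \<theta>1_def[symmetric] \<theta>2_def[symmetric] ABCE[symmetric]
      gG_def[symmetric] gS_def[symmetric] M_def[symmetric]
  proof (intro exI[of _ f] conjI f allI impI ballI, unfold f_nodes)
    show "invertible_mat (1\<^sub>m m + A)"
      by (rule dominant_invertible[OF carr(1,2) rows1 q(2)])
    show "invertible_mat (1\<^sub>m (m + 1) + E)"
      by (rule dominant_invertible[OF carr(4,3) rows2' q(2)])
  qed (use f_unique solution converges in blast)+
qed

end
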